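(* For each $n\in\mathbb{N}$, let $X_n$ be the random variable $A\mapsto|A|$ on $\mathcal{A}_n$ equipped with the uniform distribution, so that $\mathbb{P}(X_n=k)=\alpha_{n,k}/\alpha_n$, and let $Y_n$ be a binomially distributed random variable with parameters $n$ and $\tfrac12$. Then for every $r\in\mathbb{N}$, \[\lim_{n\to\infty}\frac{\mathbb{E}(X_n^r)}{\mathbb{E}(Y_n^r)}=1.\]
   Context: $\mathcal{P}_{\mathrm{fin},0}(\mathbb{N}_0)$ is the monoid of finite subsets of $\mathbb{N}_0$ containing $0$ under sumset $A+B=\{a+b: a\in A, b\in B\}$, with identity $\{0\}$. An atom is an element $A\ne\{0\}$ such that $A=B+C$ with $B,C\in\mathcal{P}_{\mathrm{fin},0}(\mathbb{N}_0)$ implies $B=\{0\}$ or $C=\{0\}$; let $\mathcal{A}$ be the set of atoms. For $n,k\in\mathbb{N}$, $\mathcal{A}_n=\{A\in\mathcal{A}: \max A\le n\}$, $\alpha_n=|\mathcal{A}_n|$, $\mathcal{A}_{n,k}=\{A\in\mathcal{A}_n : |A|=k\}$ and $\alpha_{n,k}=|\mathcal{A}_{n,k}|$. *)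

theory Defs
  imports "HOL-Probability.Probability" "HOL-Library.Set_Algebras"
begin

(* The sumset operation is the instance of + on sets from Set_Algebras. *)

definition P_fin0 :: "nat set set" where
  "P_fin0 = {A. finite A \<and> 0 \<in> A}"

definition atoms :: "nat set set" where
  "atoms = {A \<in> P_fin0. A \<noteq> {0} \<and>
     (\<forall>B \<in> P_fin0. \<forall>C \<in> P_fin0. A = B + C \<longrightarrow> B = {0} \<or> C = {0})}"

definition atoms_le :: "nat \<Rightarrow> nat set set" where
  "atoms_le n = {A \<in> atoms. Max A \<le> n}"

definition alpha :: "nat \<Rightarrow> nat" where
  "alpha n = card (atoms_le n)"

definition atoms_le_card :: "nat \<Rightarrow> nat \<Rightarrow> nat set set" where
  "atoms_le_card n k = {A \<in> atoms_le n. card A = k}"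

definition alpha_card :: "nat \<Rightarrow> nat \<Rightarrow> nat" where
  "alpha_card n k = card (atoms_le_card n k)"

lemma finite_atoms_le: "finite (atoms_le n)"
proof (rule finite_subset)
  show "atoms_le n \<subseteq> Pow {..n}"
  proof (intro subsetI PowI)
    fix A x assume "A \<in> atoms_le n" "x \<in> A"
    then have "finite A" "Max A \<le> n"
      by (auto simp: atoms_le_def atoms_def P_fin0_def)
    with \<open>x \<in> A\<close> show "x \<in> {..n}"
      by (metis Max_ge atMost_iff order_trans)
  qed
qed simp

lemma zero_one_atom: "{0, 1} \<in> atoms"
proof -
  have "B = {0} \<or> C = {0}"
    if B: "B \<in> P_fin0" and C: "C \<in> P_fin0" and eq: "{0, 1} = B + C" for B C :: "nat set"
  proof (rule ccontr)
    assume *: "\<not> (B = {0} \<or> C = {0})"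
    have "0 \<in> B" "0 \<in> C" using B C by (auto simp: P_fin0_def)
    with * obtain b c where bc: "b \<in> B" "b \<noteq> 0" "c \<in> C" "c \<noteq> 0" by blast
    then have "b + c \<in> {0, 1}" unfolding eq by (intro set_plus_intro)
    with bc show False by auto
  qed
  moreover have "{0, 1::nat} \<noteq> {0}" by auto
  ultimately show ?thesis unfolding atoms_def by (auto simp: P_fin0_def)
qed

lemma atoms_le_nonempty: "n \<ge> 1 \<Longrightarrow> atoms_le n \<noteq> {}"
  using zero_one_atom by (auto simp: atoms_le_def)

lemma prob_card_atom:
  assumes "n \<ge> 1"
  shows "measure_pmf.prob (pmf_of_set (atoms_le n)) {A. card A = k}
           = real (alpha_card n k) / real (alpha n)"
proof -
  have "atoms_le n \<inter> {A. card A = k} = atoms_le_card n k"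
    by (auto simp: atoms_le_card_def)
  then show ?thesis
    by (simp add: measure_pmf_of_set[OF atoms_le_nonempty[OF assms] finite_atoms_le]
        alpha_card_def alpha_def)
qed

end

theory Submission
  imports Defs "HOL-Real_Asymp.Real_Asymp"
begin

text \<open>
  Almost every subset \<open>A\<close> of \<open>{0..n}\<close> containing \<open>0\<close> is an atom. Suppose \<open>A = B + C\<close> nontrivially and
  let \<open>s\<close> be the integer part of the cube root of \<open>n\<close>. If \<open>B \<subseteq> {0..s}\<close>, then every \<open>a \<in> A\<close> has some
  \<open>\<beta> \<in> B\<close> with \<open>a - \<beta> + B \<subseteq> A\<close>; on each of about \<open>n / (2s + 1)\<close> disjoint windows around centres \<open>a\<close>
  this leaves at most \<open>7/8\<close> of all patterns, which beats the \<open>2 ^ (s + 1)\<close> choices of \<open>B\<close>. If both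
  maxima are at least \<open>s\<close>, with sum \<open>m\<close>, then either \<open>A\<close> contains every \<open>y\<close> with \<open>s \<le> y \<le> m - s\<close>, which
  happens for few \<open>A\<close>, or such a \<open>y\<close> is missing from \<open>B + C\<close>, which excludes one of four
  configurations for each of the at least \<open>s\<close> disjoint pairs \<open>(i, y - i)\<close>.

  Since \<open>E(Y\<^sub>n\<^sup>r) \<ge> (n/2)\<^sup>r / 2\<close>, neither the negligible set of non-atoms nor the shift
  \<open>|A| = 1 + |A - {0}|\<close> affects the ratio of the \<open>r\<close>-th moments in the limit.
\<close>

section \<open>Counting sets under independent local constraints\<close>

text \<open>The traces of a uniformly random subset of \<open>U\<close> on disjoint windows are
  independent, so each constraint costs a factor \<open>q\<close>. In the induction this is the
  injection sending \<open>A\<close> to its trace on \<open>W j\<close> and the remainder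
  \<open>A - W j\<close>. It is applied below with \<open>q = 7/8\<close> and with
  \<open>q = 3/4\<close>.\<close>

lemma card_subsets_local_constraints_le:
  fixes q :: real
  assumes "finite I" "finite U" "0 \<le> q"
    and "disjoint_family_on W I"
    and "\<And>i. i \<in> I \<Longrightarrow> W i \<subseteq> U"
    and "\<And>i. i \<in> I \<Longrightarrow> F i \<subseteq> Pow (W i)"
    and "\<And>i. i \<in> I \<Longrightarrow> real (card (F i)) \<le> q * 2 ^ card (W i)"
  shows "real (card {A. A \<subseteq> U \<and> (\<forall>i\<in>I. A \<inter> W i \<in> F i)}) \<le> q ^ card I * 2 ^ card U"
  using assms
proof (induction I arbitrary: U rule: finite_induct)
  case empty
  then show ?case by (simp flip: Pow_def add: card_Pow)
next
  case (insert j I)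
  define G where "G U I = {A. A \<subseteq> U \<and> (\<forall>i\<in>I. A \<inter> W i \<in> F i)}" for U I
  have disj: "W i \<inter> W j = {}" if "i \<in> I" for i
    using insert.prems(3) insert.hyps that by (auto simp: disjoint_family_on_def)
  have Wj: "W j \<subseteq> U" "finite (W j)"
    using insert.prems(1,4) by (auto intro: finite_subset)
  have Fj: "finite (F j)"
    using insert.prems(5)[of j] Wj by (auto intro: finite_subset)
  have finG: "finite (G (U - W j) I)"
    unfolding G_def using insert.prems(1) by simp
  have IH: "real (card (G (U - W j) I)) \<le> q ^ card I * 2 ^ card (U - W j)"
    unfolding G_def
  proof (rule insert.IH)
    show "finite (U - W j)" using insert.prems(1) by simp
    show "0 \<le> q" by fact
    show "disjoint_family_on W I"
      using insert.prems(3) by (auto simp: disjoint_family_on_def)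
    show "W i \<subseteq> U - W j" "F i \<subseteq> Pow (W i)" "real (card (F i)) \<le> q * 2 ^ card (W i)"
      if "i \<in> I" for i
      using insert.prems(4)[of i] disj[OF that] insert.prems(5)[of i] insert.prems(6)[of i] that
      by blast+
  qed
  have "(\<lambda>A. (A \<inter> W j, A - W j)) ` G U (insert j I) \<subseteq> F j \<times> G (U - W j) I"
  proof -
    have "(A - W j) \<inter> W i = A \<inter> W i" if "i \<in> I" for A i
      using disj[OF that] by auto
    then show ?thesis unfolding G_def by auto
  qed
  moreover have "inj_on (\<lambda>A. (A \<inter> W j, A - W j)) (G U (insert j I))"
    by (intro inj_onI) blast
  ultimately have "card (G U (insert j I)) \<le> card (F j \<times> G (U - W j) I)"
    using Fj finG by (intro card_inj_on_le) auto
  then have "real (card (G U (insert j I))) \<le> real (card (F j)) * real (card (G (U - W j) I))"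
    by (metis card_cartesian_product of_nat_le_iff of_nat_mult)
  also have "\<dots> \<le> (q * 2 ^ card (W j)) * (q ^ card I * 2 ^ card (U - W j))"
    using insert.prems(6)[of j] IH insert.prems(2) by (intro mult_mono) auto
  also have "\<dots> = q ^ card (insert j I) * 2 ^ (card (W j) + card (U - W j))"
    using insert.hyps by (simp add: power_add algebra_simps)
  also have "card (W j) + card (U - W j) = card U"
    using Wj insert.prems(1) by (metis card_Diff_subset card_mono le_add_diff_inverse)
  finally show ?case unfolding G_def .
qed

section \<open>Sumsets with one summand of small maximum\<close>

lemma card_supersets_within:
  assumes "finite W" "T \<subseteq> W"
  shows "card {V. T \<subseteq> V \<and> V \<subseteq> W} = 2 ^ (card W - card T)"
proof -
  have "bij_betw (\<lambda>V. V - T) {V. T \<subseteq> V \<and> V \<subseteq> W} (Pow (W - T))"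
    by (rule bij_betw_byWitness[where f' = "\<lambda>V. V \<union> T"]) (use assms in auto)
  then show ?thesis
    using assms by (simp add: bij_betw_same_card card_Pow card_Diff_subset finite_subset)
qed

text \<open>Rewritten as \<open>k / 2 ^ k \<le> 3/8\<close>, this is the room that a union bound
  over \<open>k\<close> translates has. It is an equality at \<open>k = 3\<close> and fails at
  \<open>k = 2\<close>.\<close>

lemma eight_mult_le_three_power: "3 \<le> k \<Longrightarrow> 8 * k \<le> 3 * 2 ^ k" for k :: nat
  by (induction k rule: dec_induct) auto

text \<open>For a random \<open>V\<close> in the window, \<open>a\<close> is absent with probability
  1/2. Otherwise \<open>V\<close> contains one of the \<open>card B\<close> translates of
  \<open>B\<close>, each with probability \<open>1 / 2 ^ card B\<close>. For
  \<open>card B \<ge> 3\<close> the total is at most 1/2 + 3/8. The window has radius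
  \<open>s\<close> so that every such translate fits into it.\<close>

lemma card_window_patterns_le:
  fixes B :: "nat set"
  assumes B: "B \<subseteq> {..s}" "0 \<in> B" "B \<noteq> {0}" and "s \<le> a"
  defines "W \<equiv> {a - s..a + s}"
  shows "real (card {V. V \<subseteq> W \<and> (a \<in> V \<longrightarrow> (\<exists>\<beta>\<in>B. (\<lambda>x. a - \<beta> + x) ` B \<subseteq> V))})
           \<le> 7 / 8 * 2 ^ card W"
proof -
  let ?F = "{V. V \<subseteq> W \<and> (a \<in> V \<longrightarrow> (\<exists>\<beta>\<in>B. (\<lambda>x. a - \<beta> + x) ` B \<subseteq> V))}"
  have finB: "finite B" using B finite_subset by blast
  have finW: "finite W" by (simp add: W_def)
  have cW: "card W = Suc (2 * s)" using \<open>s \<le> a\<close> by (simp add: W_def)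
  have aW: "a \<in> W" by (simp add: W_def)
  obtain b where b: "b \<in> B" "b \<noteq> 0" using B by blast
  have bs: "b \<le> s" using b B by auto
  have "card {0, b} \<le> card B" using B b finB by (intro card_mono) auto
  then consider "card B = 2" | "3 \<le> card B" using b by fastforce
  then show ?thesis
  proof cases
    \<comment> \<open>The union bound of the other case is trivial for two-element \<open>B\<close>.\<close>
    case 1
    then have "B = {0, b}"
      using card_subset_eq[OF finB, of "{0, b}"] B b by auto
    \<comment> \<open>For \<open>B = {0, b}\<close> the two translates are \<open>{a, a + b}\<close>
      and \<open>{a - b, a}\<close>. A pattern meeting \<open>?X\<close> exactly in \<open>a\<close>
      contains neither, and these patterns make up 1/8 of all.\<close>
    let ?X = "{a - b, a, a + b}"
    have X: "?X \<subseteq> W" "card ?X = 3" using \<open>s \<le> a\<close> bs b by (auto simp: W_def card_insert_if)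
    have "card (W - ?X) = 2 * s - 2"
      using X finW cW by (subst card_Diff_subset) auto
    moreover have "inj_on (insert a) (Pow (W - ?X))" by (intro inj_onI) auto
    ultimately have c: "card (insert a ` Pow (W - ?X)) = 2 ^ (2 * s - 2)"
      using finW by (simp add: card_image card_Pow)
    have "?F \<subseteq> Pow W - insert a ` Pow (W - ?X)"
      using \<open>B = {0, b}\<close> b bs \<open>s \<le> a\<close> by auto
    then have "card ?F \<le> card (Pow W - insert a ` Pow (W - ?X))"
      using finW by (intro card_mono) auto
    also have "\<dots> = 2 ^ Suc (2 * s) - 2 ^ (2 * s - 2)"
      using finW aW by (subst card_Diff_subset) (auto simp: c cW card_Pow)
    finally have "card ?F \<le> 2 ^ Suc (2 * s) - 2 ^ (2 * s - 2)" .
    \<comment> \<open>Since \<open>0 < b \<le> s\<close>, the subtraction in the exponent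
      \<open>2 * s - 2\<close> does not truncate.\<close>
    moreover obtain s' where "s = Suc s'" using b bs by (cases s) auto
    ultimately have "8 * card ?F \<le> 7 * 2 ^ Suc (2 * s)" by simp
    then have "real (8 * card ?F) \<le> real (7 * 2 ^ Suc (2 * s))" by (simp only: of_nat_le_iff)
    then show ?thesis unfolding cW by simp
  next
    case 2
    define T where "T \<beta> = (\<lambda>x. a - \<beta> + x) ` B" for \<beta>
    have T: "T \<beta> \<subseteq> W" "card (T \<beta>) = card B" if "\<beta> \<in> B" for \<beta>
    proof -
      have "\<beta> \<le> s" "\<And>x. x \<in> B \<Longrightarrow> x \<le> s" using B(1) that by auto
      then show "T \<beta> \<subseteq> W" using \<open>s \<le> a\<close> by (fastforce simp: T_def W_def)
      show "card (T \<beta>) = card B" by (simp add: T_def card_image inj_on_def)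
    qed
    have "?F \<subseteq> Pow (W - {a}) \<union> (\<Union>\<beta>\<in>B. {V. T \<beta> \<subseteq> V \<and> V \<subseteq> W})"
      by (auto simp: T_def)
    then have "card ?F \<le> card (Pow (W - {a}) \<union> (\<Union>\<beta>\<in>B. {V. T \<beta> \<subseteq> V \<and> V \<subseteq> W}))"
      using finW finB by (intro card_mono) auto
    also have "\<dots> \<le> card (Pow (W - {a})) + (\<Sum>\<beta>\<in>B. card {V. T \<beta> \<subseteq> V \<and> V \<subseteq> W})"
      using finB by (intro order.trans[OF card_Un_le] add_left_mono card_UN_le)
    also have "\<dots> = 2 ^ (2 * s) + card B * 2 ^ (Suc (2 * s) - card B)"
      using T finW aW by (simp add: card_supersets_within card_Pow cW)
    finally have 1: "card ?F \<le> 2 ^ (2 * s) + card B * 2 ^ (Suc (2 * s) - card B)" .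
    have "card B \<le> Suc s" using card_mono[OF _ B(1)] by simp
    then have "card B \<le> Suc (2 * s)" by simp
    then have "8 * card B * 2 ^ (Suc (2 * s) - card B) \<le> 3 * 2 ^ card B * 2 ^ (Suc (2 * s) - card B)"
      using eight_mult_le_three_power[OF 2] by (intro mult_right_mono) auto
    also have "\<dots> = 3 * 2 ^ Suc (2 * s)"
      using \<open>card B \<le> Suc (2 * s)\<close> by (simp only: mult.assoc flip: power_add) simp
    finally have "8 * card ?F \<le> 7 * 2 ^ Suc (2 * s)" using 1 by simp
    then have "real (8 * card ?F) \<le> real (7 * 2 ^ Suc (2 * s))" by (simp only: of_nat_le_iff)
    then show ?thesis unfolding cW by simp
  qed
qed

text \<open>If a centre \<open>a i = \<beta> + \<gamma>\<close> lies in \<open>B + C\<close>, then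
  so does the whole translate \<open>\<gamma> + B\<close>, and
  \<open>\<gamma> = a i - \<beta>\<close>. Hence the trace on every window is one of the patterns
  just counted, whatever \<open>C\<close> is.\<close>

lemma card_multiples_le:
  fixes B :: "nat set"
  assumes B: "B \<subseteq> {..s}" "0 \<in> B" "B \<noteq> {0}"
  shows "real (card {A. A \<subseteq> {..n} \<and> (\<exists>C. A = B + C)})
           \<le> (7 / 8) ^ (Suc n div Suc (2 * s)) * 2 ^ Suc n"
proof -
  define L where "L = Suc (2 * s)"
  define J where "J = Suc n div L"
  \<comment> \<open>Centres are spaced by the window length \<open>L\<close>, so the windows are the
    residue blocks from \<open>i * L\<close> to \<open>i * L + 2 * s\<close>. This makes them
    disjoint and puts exactly \<open>J\<close> complete ones inside \<open>{..n}\<close>.\<close>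
  define a where "a i = i * L + s" for i
  define W where "W i = {a i - s..a i + s}" for i
  define F where "F i = {V. V \<subseteq> W i \<and> (a i \<in> V \<longrightarrow> (\<exists>\<beta>\<in>B. (\<lambda>x. a i - \<beta> + x) ` B \<subseteq> V))}" for i
  have W: "x \<in> W i \<longleftrightarrow> x div L = i" for x i
  proof -
    have "x \<in> W i \<longleftrightarrow> i * L \<le> x \<and> x < Suc i * L" by (auto simp: W_def a_def L_def)
    also have "\<dots> \<longleftrightarrow> x div L = i"
      by (metis L_def div_nat_eqI div_times_less_eq_dividend dividend_less_div_times
          mult.commute mult_Suc zero_less_Suc)
    finally show ?thesis .
  qed
  have JL: "J * L \<le> Suc n" by (simp add: J_def)
  have "{A. A \<subseteq> {..n} \<and> (\<exists>C. A = B + C)} \<subseteq> {A. A \<subseteq> {..n} \<and> (\<forall>i\<in>{..<J}. A \<inter> W i \<in> F i)}"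
  proof safe
    fix C i
    show "(B + C) \<inter> W i \<in> F i" unfolding F_def
    proof (intro CollectI conjI impI)
      assume "a i \<in> (B + C) \<inter> W i"
      then obtain \<beta> \<gamma> where bg: "\<beta> \<in> B" "\<gamma> \<in> C" "a i = \<beta> + \<gamma>" by (auto elim: set_plus_elim)
      have "a i - \<beta> + x \<in> (B + C) \<inter> W i" if "x \<in> B" for x
      proof -
        have "a i - \<beta> + x = x + \<gamma>" using bg by simp
        moreover have "x + \<gamma> \<in> B + C" using that bg by (intro set_plus_intro)
        moreover have "a i - \<beta> + x \<in> W i"
          using that bg B by (auto simp: W_def)
        ultimately show ?thesis by (metis IntI)
      qed
      then show "\<exists>\<beta>\<in>B. (\<lambda>x. a i - \<beta> + x) ` B \<subseteq> (B + C) \<inter> W i"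
        using bg by blast
    qed auto
  qed
  then have "card {A. A \<subseteq> {..n} \<and> (\<exists>C. A = B + C)} \<le> card {A. A \<subseteq> {..n} \<and> (\<forall>i\<in>{..<J}. A \<inter> W i \<in> F i)}"
    by (rule card_mono[rotated]) simp
  also have "real \<dots> \<le> (7 / 8) ^ card {..<J} * 2 ^ card {..n}"
  proof (rule card_subsets_local_constraints_le)
    show "disjoint_family_on W {..<J}" by (auto simp: disjoint_family_on_def W)
    show "W i \<subseteq> {..n}" if "i \<in> {..<J}" for i
    proof
      fix x assume "x \<in> W i"
      then have "x div L < J" using that by (simp add: W)
      then have "x < J * L" by (simp add: L_def div_less_iff_less_mult)
      then show "x \<in> {..n}" using JL by simp
    qed
    show "real (card (F i)) \<le> 7 / 8 * 2 ^ card (W i)" for i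
      unfolding F_def W_def by (rule card_window_patterns_le[OF B]) (simp add: a_def)
  qed (auto simp: F_def)
  finally show ?thesis by (simp add: J_def L_def)
qed

section \<open>Sumsets whose summands both have large maximum\<close>

text \<open>Such a set is determined by \<open>m\<close>, its part below \<open>s\<close>, and its
  last \<open>s\<close> positions up to \<open>m\<close>, which leaves \<open>2 ^ s * 2 ^ s\<close>
  choices for each \<open>m\<close>.\<close>

lemma card_dense_middle_le:
  "card {A. \<exists>m\<le>n. A \<subseteq> {..m} \<and> (\<forall>y. s \<le> y \<and> y + s \<le> m \<longrightarrow> y \<in> A)} \<le> Suc n * 4 ^ s"
proof -
  \<comment> \<open>\<open>A2\<close> records the top part by distance from \<open>m\<close>. The
    condition \<open>s \<le> x\<close> leaves the points below \<open>s\<close> to \<open>A1\<close>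
    alone, also when \<open>m < 2 * s\<close> and the two ends overlap.\<close>
  define f where "f = (\<lambda>(m, A1, A2). A1 \<union> {x. s \<le> x \<and> x + s \<le> m}
                   \<union> {x. s \<le> x \<and> x \<le> m \<and> m < x + s \<and> m - x \<in> A2})"
  let ?S = "{..n} \<times> Pow {..<s} \<times> Pow {..<s}"
  have "{A. \<exists>m\<le>n. A \<subseteq> {..m} \<and> (\<forall>y. s \<le> y \<and> y + s \<le> m \<longrightarrow> y \<in> A)} \<subseteq> f ` ?S"
  proof safe
    fix A m assume A: "m \<le> n" "A \<subseteq> {..m}" "\<forall>y. s \<le> y \<and> y + s \<le> m \<longrightarrow> y \<in> A"
    have "A = f (m, A \<inter> {..<s}, {j. j < s \<and> j \<le> m \<and> m - j \<in> A})"
      using A by (auto simp: f_def)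
    then show "A \<in> f ` ?S" using A by blast
  qed
  then have "card {A. \<exists>m\<le>n. A \<subseteq> {..m} \<and> (\<forall>y. s \<le> y \<and> y + s \<le> m \<longrightarrow> y \<in> A)} \<le> card ?S"
    by (intro surj_card_le) auto
  also have "\<dots> = Suc n * 4 ^ s"
    by (simp add: card_cartesian_product card_Pow flip: power_mult_distrib)
  finally show ?thesis .
qed

text \<open>A pair \<open>(B, C)\<close> is encoded as the subset \<open>B <+> C\<close> of a disjoint union.\<close>

lemma card_sums_missing_le:
  assumes "s \<le> b" "s \<le> c" "s \<le> y" "y + s \<le> b + c"
  shows "real (card {D. D \<subseteq> {..b} <+> {..c} \<and> y \<notin> (Inl -` D) + (Inr -` D)})
           \<le> (3 / 4) ^ s * 2 ^ (b + c + 2)"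
proof -
  \<comment> \<open>These are the \<open>i\<close> for which \<open>i \<le> b\<close> and
    \<open>y - i \<le> c\<close> both hold. Because \<open>i \<le> y\<close>, different
    \<open>i\<close> give disjoint pairs \<open>W i\<close>.\<close>
  define I where "I = {y - c..min b y}"
  define W :: "nat \<Rightarrow> (nat + nat) set" where "W i = {Inl i, Inr (y - i)}" for i
  let ?U = "{..b} <+> {..c} :: (nat + nat) set"
  have "s \<le> card I" using assms by (auto simp: I_def)
  have "{D. D \<subseteq> ?U \<and> y \<notin> (Inl -` D) + (Inr -` D)}
          \<subseteq> {D. D \<subseteq> ?U \<and> (\<forall>i\<in>I. D \<inter> W i \<in> Pow (W i) - {W i})}"
  proof safe
    fix D i assume D: "y \<notin> (Inl -` D) + (Inr -` D)" "i \<in> I" "D \<inter> W i = W i"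
    then have "Inl i \<in> D" "Inr (y - i) \<in> D" by (auto simp: W_def)
    then have "i + (y - i) \<in> (Inl -` D) + (Inr -` D)" by (intro set_plus_intro) auto
    with D show False by (simp add: I_def)
  qed
  then have "card {D. D \<subseteq> ?U \<and> y \<notin> (Inl -` D) + (Inr -` D)}
               \<le> card {D. D \<subseteq> ?U \<and> (\<forall>i\<in>I. D \<inter> W i \<in> Pow (W i) - {W i})}"
    by (rule card_mono[rotated]) simp
  also have "real \<dots> \<le> (3 / 4) ^ card I * 2 ^ card ?U"
  proof (rule card_subsets_local_constraints_le)
    show "disjoint_family_on W I" by (auto simp: disjoint_family_on_def W_def I_def)
    show "W i \<subseteq> ?U" if "i \<in> I" for i using that assms by (auto simp: W_def I_def)
    \<comment> \<open>Of the four traces on a pair, only the full one would produce \<open>y\<close>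
      as a sum.\<close>
    show "real (card (Pow (W i) - {W i})) \<le> 3 / 4 * 2 ^ card (W i)" for i
      by (simp add: W_def card_Diff_singleton card_Pow)
  qed (auto simp: I_def)
  also have "\<dots> \<le> (3 / 4) ^ s * 2 ^ card ?U"
    using \<open>s \<le> card I\<close> by (intro mult_right_mono power_decreasing) auto
  finally show ?thesis by (simp add: card_Plus)
qed

section \<open>Non-atoms are negligible\<close>

text \<open>The identity \<open>{0}\<close> is counted here too, so that atoms and non-atoms
  together exhaust the \<open>2 ^ n\<close> subsets of \<open>{..n}\<close> containing 0.\<close>

definition non_atoms_le :: "nat \<Rightarrow> nat set set" where
  "non_atoms_le n = {A. A \<subseteq> {..n} \<and> 0 \<in> A \<and> A \<notin> atoms}"

text \<open>A factorisation with either maximum at most \<open>s\<close> falls under the second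
  case, by commutativity of the sumset. In the third, \<open>Max B + Max C\<close> belongs to
  \<open>A\<close> and is therefore at most \<open>n\<close>. The threshold \<open>s\<close> stays
  free until the final estimate.\<close>

lemma non_atoms_le_cases:
  assumes "A \<in> non_atoms_le n"
  obtains "A = {0}"
    | B where "B \<subseteq> {..s}" "0 \<in> B" "B \<noteq> {0}" "\<exists>C. A = B + C"
    | B C where "finite B" "0 \<in> B" "finite C" "0 \<in> C" "s \<le> Max B" "s \<le> Max C"
        "Max B + Max C \<le> n" "A = B + C"
proof -
  have A: "A \<subseteq> {..n}" "finite A" "0 \<in> A" "A \<notin> atoms"
    using assms by (auto simp: non_atoms_le_def intro: finite_subset)
  show thesis
  proof (cases "A = {0}")
    case False
    then obtain B C where BC: "B \<in> P_fin0" "C \<in> P_fin0" "A = B + C" "B \<noteq> {0}" "C \<noteq> {0}"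
      using A by (auto simp: atoms_def P_fin0_def)
    then have fin: "finite B" "0 \<in> B" "finite C" "0 \<in> C" by (auto simp: P_fin0_def)
    consider "Max B \<le> s" | "Max C \<le> s" | "s \<le> Max B" "s \<le> Max C" by linarith
    then show thesis
    proof cases
      case 1
      then have "B \<subseteq> {..s}" using fin by (auto dest: Max_ge)
      then show thesis using that(2) BC fin by blast
    next
      case 2
      then have "C \<subseteq> {..s}" using fin by (auto dest: Max_ge)
      moreover have "A = C + B" using BC(3) by (simp add: add.commute)
      ultimately show thesis using that(2) BC(5) fin by blast
    next
      case 3
      have "Max B \<in> B" "Max C \<in> C" using fin by (auto intro: Max_in)
      then have "Max B + Max C \<in> A" unfolding BC(3) by (rule set_plus_intro)
      then show thesis using that(3)[of B C] 3 A(1) BC(3) fin by auto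
    qed
  qed (rule that(1))
qed

text \<open>The four terms count \<open>{0}\<close>, the sets with a summand inside
  \<open>{..s}\<close> (at most \<open>2 ^ Suc s\<close> summands), those containing the whole
  middle, and those missing a middle value \<open>y\<close>. The last term counts pairs
  \<open>(B, C)\<close> instead of sums. This is affordable because \<open>b + c \<le> n\<close>
  leaves at most \<open>2 ^ (n + 2)\<close> pairs for each of at most \<open>Suc n ^ 3\<close>
  triples \<open>(b, c, y)\<close>.\<close>

lemma card_non_atoms_le_bound:
  "real (card (non_atoms_le n)) \<le>
     1 + 2 ^ Suc s * ((7 / 8) ^ (Suc n div Suc (2 * s)) * 2 ^ Suc n)
       + real (Suc n) * 4 ^ s + real (Suc n) ^ 3 * ((3 / 4) ^ s * 2 ^ (n + 2))"
proof -
  define BB where "BB = {B. B \<subseteq> {..s} \<and> 0 \<in> B \<and> B \<noteq> {0::nat}}"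
  define SM where "SM = (\<Union>B\<in>BB. {A. A \<subseteq> {..n} \<and> (\<exists>C. A = B + C)})"
  define DM where "DM = {A. \<exists>m\<le>n. A \<subseteq> {..m} \<and> (\<forall>y. s \<le> y \<and> y + s \<le> m \<longrightarrow> y \<in> A)}"
  define J where "J = {(b, c, y). s \<le> b \<and> s \<le> c \<and> b + c \<le> n \<and> s \<le> y \<and> y + s \<le> b + c}"
  define DD :: "nat \<times> nat \<times> nat \<Rightarrow> (nat + nat) set set" where
    "DD = (\<lambda>(b, c, y). {D. D \<subseteq> {..b} <+> {..c} \<and> y \<notin> (Inl -` D) + (Inr -` D)})"
  define MS where "MS = (\<lambda>D. (Inl -` D) + (Inr -` D)) ` (\<Union>j\<in>J. DD j)"
  have finBB: "finite BB" unfolding BB_def by simp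
  have J_sub: "J \<subseteq> {..n} \<times> {..n} \<times> {..n}" by (auto simp: J_def)
  have finJ: "finite J" using J_sub by (rule finite_subset) simp
  have finDD: "finite (DD j)" for j unfolding DD_def by (cases j) simp
  have finMS: "finite MS" unfolding MS_def using finJ finDD by simp
  have finDM: "finite DM"
    by (rule finite_subset[of _ "Pow {..n}"]) (force simp: DM_def)+
  have finSM: "finite SM" unfolding SM_def using finBB by simp
  have "non_atoms_le n \<subseteq> {{0}} \<union> SM \<union> DM \<union> MS"
  proof
    fix A assume A: "A \<in> non_atoms_le n"
    then have An: "A \<subseteq> {..n}" by (simp add: non_atoms_le_def)
    from A show "A \<in> {{0}} \<union> SM \<union> DM \<union> MS"
    proof (cases rule: non_atoms_le_cases[where s = s])
      case (2 B)
      then have "A \<in> SM" using An by (auto simp: SM_def BB_def)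
      then show ?thesis by simp
    next
      case (3 B C)
      define b c where "b = Max B" and "c = Max C"
      have Bb: "B \<subseteq> {..b}" and Cc: "C \<subseteq> {..c}"
        using 3 by (auto simp: b_def c_def)
      have Abc: "A \<subseteq> {..b + c}" using Bb Cc unfolding 3(8)
        by (auto elim!: set_plus_elim simp: subset_iff intro!: add_mono)
      show ?thesis
      proof (cases "\<forall>y. s \<le> y \<and> y + s \<le> b + c \<longrightarrow> y \<in> A")
        case True
        then have "A \<in> DM" using 3(7) Abc unfolding DM_def b_def c_def by blast
        then show ?thesis by simp
      next
        case False
        then obtain y where y: "s \<le> y" "y + s \<le> b + c" "y \<notin> A" by blast
        let ?D = "B <+> C"
        have D: "Inl -` ?D = B" "Inr -` ?D = C" by auto
        have "?D \<in> DD (b, c, y)" using Bb Cc y 3(8) unfolding DD_def by (auto simp: D)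
        moreover have "(b, c, y) \<in> J" using 3 y by (simp add: J_def b_def c_def)
        moreover have "A = (Inl -` ?D) + (Inr -` ?D)" unfolding D by (rule 3(8))
        ultimately have "A \<in> MS" unfolding MS_def by blast
        then show ?thesis by simp
      qed
    qed simp
  qed
  then have "card (non_atoms_le n) \<le> card ({{0}} \<union> SM \<union> DM \<union> MS)"
    using finSM finDM finMS by (intro card_mono) simp_all
  also have "\<dots> \<le> card {{0::nat}} + card SM + card DM + card MS"
    by (meson add_le_mono card_Un_le order_refl order_trans)
  finally have "real (card (non_atoms_le n)) \<le> 1 + real (card SM) + real (card DM) + real (card MS)"
    by simp
  moreover have "real (card SM) \<le> 2 ^ Suc s * ((7 / 8) ^ (Suc n div Suc (2 * s)) * 2 ^ Suc n)"
  proof -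
    have "card SM \<le> (\<Sum>B\<in>BB. card {A. A \<subseteq> {..n} \<and> (\<exists>C. A = B + C)})"
      unfolding SM_def using finBB by (rule card_UN_le)
    then have "real (card SM) \<le> (\<Sum>B\<in>BB. real (card {A. A \<subseteq> {..n} \<and> (\<exists>C. A = B + C)}))"
      by (simp only: of_nat_le_iff flip: of_nat_sum)
    also have "\<dots> \<le> (\<Sum>B\<in>BB. (7 / 8) ^ (Suc n div Suc (2 * s)) * 2 ^ Suc n)"
      by (intro sum_mono card_multiples_le) (auto simp: BB_def)
    also have "\<dots> = real (card BB) * ((7 / 8) ^ (Suc n div Suc (2 * s)) * 2 ^ Suc n)" by simp
    also have "\<dots> \<le> 2 ^ Suc s * ((7 / 8) ^ (Suc n div Suc (2 * s)) * 2 ^ Suc n)"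
    proof (rule mult_right_mono)
      have "card BB \<le> card (Pow {..s})" by (intro card_mono) (auto simp: BB_def)
      then have "card BB \<le> 2 ^ Suc s" by (simp add: card_Pow)
      then show "real (card BB) \<le> 2 ^ Suc s" by (metis of_nat_le_iff of_nat_numeral of_nat_power)
    qed simp
    finally show ?thesis .
  qed
  moreover have "real (card DM) \<le> real (Suc n) * 4 ^ s"
  proof -
    have "real (card DM) \<le> real (Suc n * 4 ^ s)"
      unfolding DM_def of_nat_le_iff by (rule card_dense_middle_le)
    then show ?thesis by (simp only: of_nat_mult of_nat_power of_nat_numeral)
  qed
  moreover have "real (card MS) \<le> real (Suc n) ^ 3 * ((3 / 4) ^ s * 2 ^ (n + 2))"
  proof -
    have "card MS \<le> card (\<Union>j\<in>J. DD j)"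
      unfolding MS_def using finJ finDD by (intro card_image_le) simp
    also have "\<dots> \<le> (\<Sum>j\<in>J. card (DD j))" using finJ by (rule card_UN_le)
    finally have "real (card MS) \<le> (\<Sum>j\<in>J. real (card (DD j)))"
      by (simp only: of_nat_le_iff flip: of_nat_sum)
    also have "\<dots> \<le> (\<Sum>j\<in>J. (3 / 4) ^ s * 2 ^ (n + 2))"
    proof (rule sum_mono)
      fix j assume "j \<in> J"
      then obtain b c y where j: "j = (b, c, y)"
        and le: "s \<le> b" "s \<le> c" "s \<le> y" "y + s \<le> b + c" "b + c \<le> n"
        by (auto simp: J_def)
      have "real (card (DD j)) \<le> (3 / 4) ^ s * 2 ^ (b + c + 2)"
        unfolding DD_def j prod.case by (rule card_sums_missing_le) (use le in auto)
      also have "\<dots> \<le> (3 / 4) ^ s * 2 ^ (n + 2)"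
        using le by (intro mult_left_mono power_increasing) auto
      finally show "real (card (DD j)) \<le> (3 / 4) ^ s * 2 ^ (n + 2)" .
    qed
    also have "\<dots> = real (card J) * ((3 / 4) ^ s * 2 ^ (n + 2))" by simp
    also have "\<dots> \<le> real (Suc n) ^ 3 * ((3 / 4) ^ s * 2 ^ (n + 2))"
    proof (rule mult_right_mono)
      have "card J \<le> card ({..n} \<times> {..n} \<times> {..n})" using J_sub by (intro card_mono) auto
      then have "card J \<le> Suc n ^ 3" by (simp add: card_cartesian_product power3_eq_cube algebra_simps)
      then show "real (card J) \<le> real (Suc n) ^ 3" by (metis of_nat_le_iff of_nat_power)
    qed simp
    finally show ?thesis .
  qed
  ultimately show ?thesis by linarith
qed

text \<open>With \<open>s\<close> near the cube root of \<open>n\<close> there are about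
  \<open>s ^ 2 / 2\<close> windows, so the window factor beats \<open>2 ^ (s + 2)\<close>, while
  \<open>(3/4) ^ s\<close> still beats the polynomial factor, of order \<open>s ^ 9\<close>.\<close>

lemma non_atoms_le_negligible: "(\<lambda>n. real (card (non_atoms_le n)) / 2 ^ n) \<longlonglongrightarrow> 0"
proof -
  \<comment> \<open>Using \<open>s ^ 3 \<le> n\<close> and \<open>n + 1 \<le> (s + 1) ^ 3\<close>,
    every term is bounded in \<open>s\<close> alone, so one limit in \<open>s\<close> suffices. The
    \<open>- 1\<close> in the exponent pays for rounding down in the number of windows.\<close>
  define g :: "nat \<Rightarrow> real" where "g s = 1 / 2 powr (real s ^ 3)
    + 2 ^ (s + 2) * (7 / 8) powr (real s ^ 3 / (2 * real s + 1) - 1)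
    + (real s + 1) ^ 3 * 4 ^ s / 2 powr (real s ^ 3) + 4 * (real s + 1) ^ 9 * (3 / 4) ^ s" for s
  define \<sigma> where "\<sigma> n = nat \<lfloor>root 3 (real n)\<rfloor>" for n
  have bound: "real (card (non_atoms_le n)) / 2 ^ n \<le> g (\<sigma> n)" for n
  proof -
    define s where "s = \<sigma> n"
    have s: "real s \<le> root 3 n" "root 3 n < real s + 1"
      by (simp_all add: s_def \<sigma>_def)
    have "real s ^ 3 \<le> root 3 n ^ 3" using s by (intro power_mono) auto
    then have s3: "real s ^ 3 \<le> real n" by simp
    have "root 3 n ^ 3 < (real s + 1) ^ 3" using s by (intro power_strict_mono) auto
    then have "real n < real (Suc s ^ 3)" by (simp add: add.commute)
    then have "Suc n \<le> Suc s ^ 3" by (simp only: of_nat_less_iff Suc_le_eq)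
    then have "real (Suc n) \<le> real (Suc s ^ 3)" by (simp only: of_nat_le_iff)
    then have hi: "real (Suc n) \<le> (real s + 1) ^ 3" by (simp add: add.commute)
    have pow: "2 powr (real s ^ 3) \<le> (2::real) ^ n"
      using s3 by (simp flip: powr_realpow)
    have "real (card (non_atoms_le n)) / 2 ^ n \<le>
      (1 + 2 ^ Suc s * ((7 / 8) ^ (Suc n div Suc (2 * s)) * 2 ^ Suc n)
       + real (Suc n) * 4 ^ s + real (Suc n) ^ 3 * ((3 / 4) ^ s * 2 ^ (n + 2))) / 2 ^ n"
      by (intro divide_right_mono card_non_atoms_le_bound) simp
    also have "\<dots> = 1 / 2 ^ n + 2 ^ (s + 2) * (7 / 8) ^ (Suc n div Suc (2 * s))
       + real (Suc n) * 4 ^ s / 2 ^ n + 4 * real (Suc n) ^ 3 * (3 / 4) ^ s"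
      by (simp add: add_divide_distrib power_add)
    also have "\<dots> \<le> g s" unfolding g_def
    proof (intro add_mono)
      show "1 / 2 ^ n \<le> 1 / (2::real) powr (real s ^ 3)" using pow by (intro divide_left_mono) auto
      show "real (Suc n) * 4 ^ s / 2 ^ n \<le> (real s + 1) ^ 3 * 4 ^ s / 2 powr (real s ^ 3)"
        using pow hi by (intro frac_le mult_right_mono) auto
      have "real (Suc n) ^ 3 \<le> ((real s + 1) ^ 3) ^ 3" using hi by (intro power_mono) auto
      also have "\<dots> = (real s + 1) ^ 9" by (simp flip: power_mult)
      finally show "4 * real (Suc n) ^ 3 * (3 / 4) ^ s \<le> 4 * (real s + 1) ^ 9 * (3 / 4) ^ s"
        by (intro mult_right_mono mult_left_mono) auto
      let ?d = "Suc n div Suc (2 * s)"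
      have "real s ^ 3 / (2 * real s + 1) \<le> real (Suc n) / (2 * real s + 1)"
        by (intro divide_right_mono order.trans[OF s3]) auto
      also have "\<dots> = real (Suc n) / real (Suc (2 * s))" by (simp add: add.commute)
      also have "\<dots> \<le> real ?d + 1"
      proof -
        have "Suc n \<le> (?d + 1) * Suc (2 * s)"
          using dividend_less_div_times[of "Suc (2 * s)" "Suc n"] by simp
        then have "real (Suc n) \<le> real ((?d + 1) * Suc (2 * s))" by (simp only: of_nat_le_iff)
        then have "real (Suc n) \<le> (real ?d + 1) * real (Suc (2 * s))"
          by (simp only: of_nat_mult of_nat_add of_nat_1)
        then show ?thesis by (subst pos_divide_le_eq) auto
      qed
      finally have "real s ^ 3 / (2 * real s + 1) - 1 \<le> real ?d" by simp
      \<comment> \<open>The base is below 1, so the smaller exponent gives the larger power.\<close>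
      then have "(7 / 8) powr real ?d \<le> (7 / 8 :: real) powr (real s ^ 3 / (2 * real s + 1) - 1)"
        by (intro powr_mono') auto
      then show "2 ^ (s + 2) * (7 / 8) ^ ?d
          \<le> 2 ^ (s + 2) * (7 / 8 :: real) powr (real s ^ 3 / (2 * real s + 1) - 1)"
        by (intro mult_left_mono) (simp_all add: powr_realpow)
    qed
    finally show ?thesis by (simp add: s_def)
  qed
  have "g \<longlonglongrightarrow> 0" unfolding g_def by (intro tendsto_add_zero) real_asymp+
  moreover have "filterlim \<sigma> at_top sequentially" unfolding \<sigma>_def by real_asymp
  ultimately have "(\<lambda>n. g (\<sigma> n)) \<longlonglongrightarrow> 0" by (rule filterlim_compose)
  then show ?thesis
    by (rule Lim_null_comparison[rotated]) (simp add: bound)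
qed

section \<open>Comparing moments of atoms with binomial moments\<close>

lemma atoms_le_Un_non_atoms_le:
  "atoms_le n \<union> non_atoms_le n = insert 0 ` Pow {1..n}"
  "atoms_le n \<inter> non_atoms_le n = {}"
proof -
  have "A \<in> insert 0 ` Pow {1..n} \<longleftrightarrow> A \<subseteq> {..n} \<and> 0 \<in> A" for A :: "nat set"
  proof
    assume "A \<subseteq> {..n} \<and> 0 \<in> A"
    then have "A = insert 0 (A - {0})" "A - {0} \<subseteq> {1..n}" by auto
    then show "A \<in> insert 0 ` Pow {1..n}" by blast
  qed auto
  moreover have "A \<in> atoms_le n \<longleftrightarrow> A \<subseteq> {..n} \<and> 0 \<in> A \<and> A \<in> atoms" for A
  proof (cases "A \<in> atoms")
    case True
    then have "finite A" "0 \<in> A" by (auto simp: atoms_def P_fin0_def)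
    then have "Max A \<le> n \<longleftrightarrow> A \<subseteq> {..n}" by (subst Max_le_iff) auto
    then show ?thesis using True \<open>0 \<in> A\<close> by (simp add: atoms_le_def)
  qed (simp add: atoms_le_def)
  ultimately show "atoms_le n \<union> non_atoms_le n = insert 0 ` Pow {1..n}"
    by (simp add: non_atoms_le_def set_eq_iff) blast
  show "atoms_le n \<inter> non_atoms_le n = {}"
    by (auto simp: non_atoms_le_def atoms_le_def)
qed

lemma finite_non_atoms_le: "finite (non_atoms_le n)"
  by (simp add: non_atoms_le_def)

lemma sum_atoms_le_non_atoms_le:
  fixes f :: "nat set \<Rightarrow> 'a :: comm_monoid_add"
  shows "sum f (atoms_le n) + sum f (non_atoms_le n) = (\<Sum>T\<in>Pow {1..n}. f (insert 0 T))"
proof -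
  have "inj_on (insert 0) (Pow {1..n})"
    by (rule inj_on_inverseI[where g = "\<lambda>A. A - {0}"]) auto
  then show ?thesis
    using sum.union_disjoint[OF finite_atoms_le finite_non_atoms_le, of n n f]
    by (simp add: atoms_le_Un_non_atoms_le sum.reindex)
qed

lemma card_atoms_le_eq: "real (card (atoms_le n)) = 2 ^ n - real (card (non_atoms_le n))"
  using sum_atoms_le_non_atoms_le[of "\<lambda>_. 1::real" n] by (simp add: card_Pow)

text \<open>Pair each \<open>T\<close> with its complement: one of the two has at least half of the
  elements. This lower bound on the binomial moment is what both error terms are later measured
  against.\<close>

lemma sum_card_power_Pow_ge:
  fixes S :: "'a set"
  assumes "finite S"
  shows "2 ^ card S * (real (card S) / 2) ^ r \<le> 2 * (\<Sum>T\<in>Pow S. real (card T) ^ r)"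
proof -
  have "(\<Sum>T\<in>Pow S. real (card T) ^ r) = (\<Sum>T\<in>Pow S. real (card (S - T)) ^ r)"
    by (rule sum.reindex_bij_witness[of _ "\<lambda>T. S - T" "\<lambda>T. S - T"]) (auto simp: double_diff)
  then have "2 * (\<Sum>T\<in>Pow S. real (card T) ^ r)
      = (\<Sum>T\<in>Pow S. real (card T) ^ r + real (card (S - T)) ^ r)"
    by (simp add: sum.distrib)
  also have "\<dots> \<ge> (\<Sum>T\<in>Pow S. (real (card S) / 2) ^ r)"
  proof (rule sum_mono)
    fix T assume "T \<in> Pow S"
    then have "card T + card (S - T) = card S"
      using assms by (metis PowD card_Diff_subset card_mono finite_subset le_add_diff_inverse)
    then consider "real (card S) / 2 \<le> real (card T)" | "real (card S) / 2 \<le> real (card (S - T))"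
      by linarith
    then show "(real (card S) / 2) ^ r \<le> real (card T) ^ r + real (card (S - T)) ^ r"
    proof cases
      case 1
      then have "(real (card S) / 2) ^ r \<le> real (card T) ^ r" by (intro power_mono) auto
      then show ?thesis by (simp add: add_increasing2)
    next
      case 2
      then have "(real (card S) / 2) ^ r \<le> real (card (S - T)) ^ r" by (intro power_mono) auto
      then show ?thesis by (simp add: add_increasing)
    qed
  qed
  finally show ?thesis using assms by (simp add: card_Pow)
qed

text \<open>The size of a uniformly random subset of \<open>{1..n}\<close> is binomial. This form
  makes the moment directly comparable with a sum over sets \<open>insert 0 T\<close>.\<close>

lemma expectation_binomial_half:
  "measure_pmf.expectation (binomial_pmf n (1 / 2)) f = (\<Sum>T\<in>Pow {1..n}. f (card T)) / 2 ^ n"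
  for f :: "nat \<Rightarrow> real"
proof -
  have "(\<Sum>T\<in>Pow {1..n}. f (card T)) = (\<Sum>k\<le>n. \<Sum>T\<in>{T \<in> Pow {1..n}. card T = k}. f (card T))"
    by (rule sum.group[symmetric]) (auto dest: card_mono[rotated])
  also have "\<dots> = (\<Sum>k\<le>n. real (n choose k) * f k)"
    by (intro sum.cong refl) (simp add: n_subsets)
  finally have *: "(\<Sum>T\<in>Pow {1..n}. f (card T)) = (\<Sum>k\<le>n. real (n choose k) * f k)" .
  have "(1 / 2) ^ k * (1 / 2) ^ (n - k) = (1 / 2 ^ n :: real)" if "k \<le> n" for k
    using that by (simp add: power_one_over flip: power_add)
  then show ?thesis
    unfolding * by (simp add: expectation_binomial_pmf' sum_divide_distrib mult.assoc)
qed

text \<open>A discrete mean value estimate: adjoining 0 to a set changes the \<open>r\<close>-th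
  power of its size only by a term of degree \<open>r - 1\<close>.\<close>

lemma Suc_power_diff_le: "(real t + 1) ^ r - real t ^ r \<le> real r * (real t + 1) ^ (r - 1)"
proof (induction r)
  case (Suc r)
  have "(real t + 1) ^ Suc r - real t ^ Suc r
      = (real t + 1) * ((real t + 1) ^ r - real t ^ r) + real t ^ r"
    by (simp add: algebra_simps)
  also have "\<dots> \<le> (real t + 1) * (real r * (real t + 1) ^ (r - 1)) + (real t + 1) ^ r"
    using Suc.IH by (intro add_mono mult_left_mono power_mono) auto
  also have "\<dots> = real (Suc r) * (real t + 1) ^ (Suc r - 1)"
    by (cases r) (auto simp: algebra_simps)
  finally show ?case .
qed simp

text \<open>Adding the non-atoms turns the sum over atoms into the sum of
  \<open>(card T + 1) ^ r\<close>. So the difference is the cost of the shift by one minus the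
  contribution of the non-atoms, both nonnegative, and its absolute value is at most the sum of
  their bounds.\<close>

lemma abs_sum_card_power_atoms_diff_le:
  "\<bar>(\<Sum>A\<in>atoms_le n. real (card A) ^ r) - (\<Sum>T\<in>Pow {1..n}. real (card T) ^ r)\<bar>
     \<le> real (card (non_atoms_le n)) * (real n + 1) ^ r + 2 ^ n * (real r * (real n + 1) ^ (r - 1))"
proof -
  define SA SN SY where "SA = (\<Sum>A\<in>atoms_le n. real (card A) ^ r)"
    and "SN = (\<Sum>A\<in>non_atoms_le n. real (card A) ^ r)"
    and "SY = (\<Sum>T\<in>Pow {1..n}. real (card T) ^ r)"
  have cT: "finite T" "card T \<le> n" "card (insert 0 T) = Suc (card T)" if "T \<in> Pow {1..n}" for T
  proof -
    show fin: "finite T" using that by (auto intro: finite_subset)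
    show "card T \<le> n" using that card_mono[of "{1..n}" T] by simp
    have "0 \<notin> T" using that by auto
    then show "card (insert 0 T) = Suc (card T)" using fin by simp
  qed
  have "SA + SN = (\<Sum>T\<in>Pow {1..n}. real (card (insert 0 T)) ^ r)"
    unfolding SA_def SN_def by (rule sum_atoms_le_non_atoms_le)
  also have "\<dots> = (\<Sum>T\<in>Pow {1..n}. (real (card T) + 1) ^ r)"
    by (intro sum.cong refl) (simp add: cT add.commute)
  finally have "SA + SN - SY = (\<Sum>T\<in>Pow {1..n}. (real (card T) + 1) ^ r - real (card T) ^ r)"
    by (simp add: SY_def sum_subtractf)
  moreover have "0 \<le> (\<Sum>T\<in>Pow {1..n}. (real (card T) + 1) ^ r - real (card T) ^ r)"
    by (intro sum_nonneg) (simp add: power_mono)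
  moreover have "(\<Sum>T\<in>Pow {1..n}. (real (card T) + 1) ^ r - real (card T) ^ r)
      \<le> (\<Sum>T\<in>Pow {1..n}. real r * (real n + 1) ^ (r - 1))"
  proof (rule sum_mono)
    fix T assume "T \<in> Pow {1..n}"
    from cT(2)[OF this] have "real r * (real (card T) + 1) ^ (r - 1) \<le> real r * (real n + 1) ^ (r - 1)"
      by (intro mult_left_mono power_mono) auto
    then show "(real (card T) + 1) ^ r - real (card T) ^ r \<le> real r * (real n + 1) ^ (r - 1)"
      by (rule order.trans[OF Suc_power_diff_le])
  qed
  moreover have "0 \<le> SN" unfolding SN_def by (intro sum_nonneg) simp
  moreover have "SN \<le> (\<Sum>A\<in>non_atoms_le n. (real n + 1) ^ r)"
    unfolding SN_def
  proof (intro sum_mono power_mono)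
    fix A assume "A \<in> non_atoms_le n"
    then have "card A \<le> card {..n}" by (intro card_mono) (auto simp: non_atoms_le_def)
    then show "real (card A) \<le> real n + 1" by simp
  qed simp
  ultimately have "\<bar>SA - SY\<bar> \<le> real (card (non_atoms_le n)) * (real n + 1) ^ r
      + 2 ^ n * (real r * (real n + 1) ^ (r - 1))"
    by (simp add: card_Pow)
  then show ?thesis by (simp add: SA_def SY_def)
qed

lemma sum_card_power_atoms_ratio:
  assumes "1 \<le> r"
  shows "(\<lambda>n. (\<Sum>A\<in>atoms_le n. real (card A) ^ r) / (\<Sum>T\<in>Pow {1..n}. real (card T) ^ r)) \<longlonglongrightarrow> 1"
proof -
  define SA SY where "SA n = (\<Sum>A\<in>atoms_le n. real (card A) ^ r)"
    and "SY n = (\<Sum>T\<in>Pow {1..n}. real (card T) ^ r)" for n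
  define \<epsilon> where "\<epsilon> n = real (card (non_atoms_le n)) / 2 ^ n" for n
  \<comment> \<open>This is the preceding error bound divided by the lower bound
    \<open>2 ^ n * (n / 2) ^ r / 2\<close> for \<open>SY n\<close>: a multiple of
    \<open>\<epsilon> n\<close> with bounded factor, plus a term of order
    \<open>1 / n\<close>.\<close>
  define h where "h n = 2 * (\<epsilon> n * (2 ^ r * ((real n + 1) / real n) ^ r)
      + real r * (real n + 1) ^ (r - 1) / (real n / 2) ^ r)" for n
  have bound: "norm (SA n / SY n - 1) \<le> h n" if "n \<ge> 1" for n
  proof -
    define l where "l = 2 ^ n * (real n / 2) ^ r / 2"
    have l: "0 < l" using that by (simp add: l_def)
    have SY: "l \<le> SY n"
      using sum_card_power_Pow_ge[of "{1..n}" r] by (simp add: l_def SY_def)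
    have "norm (SA n / SY n - 1) = \<bar>SA n - SY n\<bar> / SY n"
      using l SY by (simp add: field_simps abs_divide)
    also have "\<dots> \<le> (real (card (non_atoms_le n)) * (real n + 1) ^ r
        + 2 ^ n * (real r * (real n + 1) ^ (r - 1))) / l"
      using l SY abs_sum_card_power_atoms_diff_le[where n = n and r = r]
      by (intro frac_le) (auto simp: SA_def SY_def)
    also have "\<dots> = h n"
      using that by (simp add: h_def l_def \<epsilon>_def field_simps power_mult_distrib)
    finally show ?thesis .
  qed
  have "\<epsilon> \<longlonglongrightarrow> 0" unfolding \<epsilon>_def by (rule non_atoms_le_negligible)
  moreover have "(\<lambda>n. (real n + 1) / real n) \<longlonglongrightarrow> 1" by real_asymp
  moreover have "(\<lambda>n. real r * (real n + 1) ^ (r - 1) / (real n / 2) ^ r) \<longlonglongrightarrow> 0"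
  proof -
    \<comment> \<open>Here \<open>r \<ge> 1\<close> enters: the shift term becomes
      \<open>((n + 1) / n) ^ q\<close> times a constant over \<open>n\<close>.\<close>
    obtain q where q: "r = Suc q" using assms by (cases r) auto
    have "(\<lambda>n. ((real n + 1) / real n) ^ q * (2 ^ r * real r / real n)) \<longlonglongrightarrow> 1 ^ q * 0"
      by (intro tendsto_mult tendsto_power) real_asymp+
    moreover have "((real n + 1) / real n) ^ q * (2 ^ r * real r / real n)
        = real r * (real n + 1) ^ (r - 1) / (real n / 2) ^ r" for n
      by (simp add: q field_simps power_mult_distrib)
    ultimately show ?thesis by simp
  qed
  ultimately have "h \<longlonglongrightarrow> 2 * (0 * (2 ^ r * 1 ^ r) + 0)"
    unfolding h_def by (intro tendsto_intros)
  then have "h \<longlonglongrightarrow> 0" by simp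
  then have "(\<lambda>n. SA n / SY n - 1) \<longlonglongrightarrow> 0"
    by (rule Lim_null_comparison[rotated]) (use bound in \<open>auto simp: eventually_sequentially\<close>)
  then show ?thesis unfolding SA_def SY_def by (simp add: LIM_zero_iff)
qed

theorem theorem5p4:
  fixes M :: "nat \<Rightarrow> 'b measure" and Y :: "nat \<Rightarrow> 'b \<Rightarrow> nat" and r :: nat
  assumes "\<And>n. n \<ge> 1 \<Longrightarrow> prob_space (M n)"
    and "\<And>n. n \<ge> 1 \<Longrightarrow> Y n \<in> measurable (M n) (count_space UNIV)"
    and "\<And>n. n \<ge> 1 \<Longrightarrow>
           distr (M n) (count_space UNIV) (Y n) = measure_pmf (binomial_pmf n (1/2))"
    and "r \<ge> 1"
  shows "(\<lambda>n. measure_pmf.expectation (pmf_of_set (atoms_le n)) (\<lambda>A. real (card A) ^ r)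
              / prob_space.expectation (M n) (\<lambda>\<omega>. real (Y n \<omega>) ^ r))
           \<longlonglongrightarrow> 1"
proof -
  define SA SY where "SA n = (\<Sum>A\<in>atoms_le n. real (card A) ^ r)"
    and "SY n = (\<Sum>T\<in>Pow {1..n}. real (card T) ^ r)" for n
  define \<epsilon> where "\<epsilon> n = real (card (non_atoms_le n)) / 2 ^ n" for n
  \<comment> \<open>The two means are normalised differently, by
    \<open>2 ^ n * (1 - \<epsilon> n)\<close> atoms and by \<open>2 ^ n\<close> subsets, which
    leaves the factor \<open>1 / (1 - \<epsilon> n)\<close>.\<close>
  have eq: "SA n / SY n / (1 - \<epsilon> n)
      = measure_pmf.expectation (pmf_of_set (atoms_le n)) (\<lambda>A. real (card A) ^ r)
          / prob_space.expectation (M n) (\<lambda>\<omega>. real (Y n \<omega>) ^ r)" if "n \<ge> 1" for n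
  proof -
    have "measure_pmf.expectation (pmf_of_set (atoms_le n)) (\<lambda>A. real (card A) ^ r)
        = SA n / card (atoms_le n)"
      unfolding SA_def by (rule integral_pmf_of_set[OF atoms_le_nonempty[OF that] finite_atoms_le])
    also have "real (card (atoms_le n)) = 2 ^ n * (1 - \<epsilon> n)"
      by (simp add: card_atoms_le_eq \<epsilon>_def field_simps)
    finally have X: "measure_pmf.expectation (pmf_of_set (atoms_le n)) (\<lambda>A. real (card A) ^ r)
        = SA n / (2 ^ n * (1 - \<epsilon> n))" .
    have "prob_space.expectation (M n) (\<lambda>\<omega>. real (Y n \<omega>) ^ r)
        = integral\<^sup>L (distr (M n) (count_space UNIV) (Y n)) (\<lambda>k. real k ^ r)"
      by (rule integral_distr[symmetric]) (use assms(2)[OF that] in auto)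
    also have "\<dots> = SY n / 2 ^ n"
      unfolding assms(3)[OF that] SY_def by (rule expectation_binomial_half)
    finally show ?thesis unfolding X by (simp add: field_simps)
  qed
  have "(\<lambda>n. SA n / SY n / (1 - \<epsilon> n)) \<longlonglongrightarrow> 1 / (1 - 0)"
    unfolding SA_def SY_def \<epsilon>_def
    by (intro tendsto_divide tendsto_diff tendsto_const sum_card_power_atoms_ratio
        non_atoms_le_negligible assms) simp
  then have "(\<lambda>n. SA n / SY n / (1 - \<epsilon> n)) \<longlonglongrightarrow> 1" by simp
  then show ?thesis
    by (rule Lim_transform_eventually)
      (use eq in \<open>auto simp: eventually_sequentially\<close>)
qed

end
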